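(* Let $\mathscr{T}=(T_{ijk})\in\mathbb{R}^{3\times 3\times 3}$ be a nonlinear susceptibility tensor, i.e. a real third-order tensor with $T_{ijk}=T_{ikj}$ for all $i,j,k\in\{1,2,3\}$. Let $d_{\text{eff}}^2$ be the maximum of the four-variable model $$d_{\text{eff}}^2=\max\left\{\mathscr{T}\boldsymbol{a}\boldsymbol{b}\boldsymbol{b}:\ a_1^2+a_2^2=1,\ z_1^2+z_2^2=1,\ a_3=0\right\},$$ where $\boldsymbol{a}=(a_1,a_2,a_3)^\top$ and $\boldsymbol{b}=(a_2z_1,-a_1z_1,z_2)^\top$ with $a_1,a_2,z_1,z_2\in\mathbb{R}$. Put $$R_{11}(\boldsymbol{a})=(T_{111}-2T_{212})a_1a_2^2+(T_{222}-2T_{112})a_1^2a_2+T_{122}a_1^3+T_{211}a_2^3,$$ $$R_{12}(\boldsymbol{a})=(T_{113}-T_{223})a_1a_2-T_{123}a_1^2+T_{213}a_2^2,\qquad R_{22}(\boldsymbol{a})=T_{133}a_1+T_{233}a_2.$$ Then the number of variables of this model can be cut in half to $2$, namely $$d_{\text{eff}}^2=\frac12\max\left\{R_{11}(\boldsymbol{a})+R_{22}(\boldsymbol{a})+\sqrt{\left(R_{11}(\boldsymbol{a})-R_{22}(\boldsymbol{a})\right)^2+4R_{12}(\boldsymbol{a})^2}:\ a_1^2+a_2^2=1\right\}.$$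
   Context: For vectors $\boldsymbol{x},\boldsymbol{y},\boldsymbol{w}\in\mathbb{R}^3$, $\mathscr{T}\boldsymbol{x}\boldsymbol{y}\boldsymbol{w}=\sum_{i,j,k=1}^3T_{ijk}x_iy_jw_k$; in particular $\mathscr{T}\boldsymbol{a}\boldsymbol{b}\boldsymbol{b}=\sum_{i,j,k=1}^3T_{ijk}a_ib_jb_k$. A nonlinear (second-order) susceptibility tensor is a real $3\times3\times3$ tensor symmetric in its last two indices (a piezoelectric-type tensor). In uniaxial crystals, $\boldsymbol{a}$ (with $a_3=0$) and $\boldsymbol{b}$ are the unit polarization vectors of the ordinary and extraordinary light; the parametrization $\boldsymbol{b}=(a_2z_1,-a_1z_1,z_2)^\top$ encodes that they are orthogonal. The functions $R_{11},R_{12},R_{22}$ are the coefficients in $\mathscr{T}\boldsymbol{a}\boldsymbol{b}\boldsymbol{b}=z_1^2R_{11}(\boldsymbol{a})+2z_1z_2R_{12}(\boldsymbol{a})+z_2^2R_{22}(\boldsymbol{a})$. The number $d_{\text{eff}}^2$ is a largest effective second-harmonic generation (SHG) coefficient. *)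

theory Defs
  imports "HOL-Analysis.Analysis"
begin

type_synonym tensor3 = "real ^ 3 ^ 3 ^ 3"

definition trilinear :: "tensor3 \<Rightarrow> real ^ 3 \<Rightarrow> real ^ 3 \<Rightarrow> real ^ 3 \<Rightarrow> real" where
  "trilinear T x y w =
     (\<Sum>i\<in>UNIV. \<Sum>j\<in>UNIV. \<Sum>k\<in>UNIV. T $ i $ j $ k * x $ i * y $ j * w $ k)"

definition susceptibility_tensor :: "tensor3 \<Rightarrow> bool" where
  "susceptibility_tensor T \<longleftrightarrow> (\<forall>i j k. T $ i $ j $ k = T $ i $ k $ j)"

text \<open>
  The polarization of the extraordinary light, orthogonal to \<open>a\<close> whenever \<open>a $ 3 = 0\<close>.
\<close>
definition extraordinary :: "real ^ 3 \<Rightarrow> real \<Rightarrow> real \<Rightarrow> real ^ 3" where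
  "extraordinary a z1 z2 = vector [a $ 2 * z1, - (a $ 1) * z1, z2]"

definition R11 :: "tensor3 \<Rightarrow> real ^ 3 \<Rightarrow> real" where
  "R11 T a = (T $ 1 $ 1 $ 1 - 2 * T $ 2 $ 1 $ 2) * a $ 1 * (a $ 2)\<^sup>2
           + (T $ 2 $ 2 $ 2 - 2 * T $ 1 $ 1 $ 2) * (a $ 1)\<^sup>2 * a $ 2
           + T $ 1 $ 2 $ 2 * (a $ 1) ^ 3 + T $ 2 $ 1 $ 1 * (a $ 2) ^ 3"

definition R12 :: "tensor3 \<Rightarrow> real ^ 3 \<Rightarrow> real" where
  "R12 T a = (T $ 1 $ 1 $ 3 - T $ 2 $ 2 $ 3) * a $ 1 * a $ 2
           - T $ 1 $ 2 $ 3 * (a $ 1)\<^sup>2 + T $ 2 $ 1 $ 3 * (a $ 2)\<^sup>2"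

definition R22 :: "tensor3 \<Rightarrow> real ^ 3 \<Rightarrow> real" where
  "R22 T a = T $ 1 $ 3 $ 3 * a $ 1 + T $ 2 $ 3 $ 3 * a $ 2"

text \<open>
  The maximum of a possibly infinite set of reals, in contrast to \<^const>\<open>Max\<close>.
  The value of \<open>maximum S\<close> is meaningful only if \<open>has_maximum S\<close>.
\<close>
definition has_maximum :: "real set \<Rightarrow> bool" where
  "has_maximum S \<longleftrightarrow> (\<exists>m\<in>S. \<forall>x\<in>S. x \<le> m)"

definition maximum :: "real set \<Rightarrow> real" where
  "maximum S = (GREATEST x. x \<in> S)"

definition four_variable_values :: "tensor3 \<Rightarrow> real set" where
  "four_variable_values T =
     {trilinear T a (extraordinary a z1 z2) (extraordinary a z1 z2) | a z1 z2.
        (a $ 1)\<^sup>2 + (a $ 2)\<^sup>2 = 1 \<and> z1\<^sup>2 + z2\<^sup>2 = 1 \<and> a $ 3 = 0}"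

text \<open>The superscript 2 of \<open>d\<^sub>e\<^sub>f\<^sub>f\<close> is part of the name of this maximum; nothing is squared.\<close>
definition d_eff2 :: "tensor3 \<Rightarrow> real" where
  "d_eff2 T = maximum (four_variable_values T)"

definition two_variable_objective :: "tensor3 \<Rightarrow> real ^ 3 \<Rightarrow> real" where
  "two_variable_objective T a =
     R11 T a + R22 T a + sqrt ((R11 T a - R22 T a)\<^sup>2 + 4 * (R12 T a)\<^sup>2)"

text \<open>
  \<open>R11\<close>, \<open>R12\<close> and \<open>R22\<close> do not depend on \<open>a $ 3\<close>, so only \<open>a1\<close> and \<open>a2\<close> are variables here.
\<close>
definition two_variable_values :: "tensor3 \<Rightarrow> real set" where
  "two_variable_values T =
     {two_variable_objective T (vector [a1, a2, 0]) | a1 a2. a1\<^sup>2 + a2\<^sup>2 = 1}"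

end

theory Submission
  imports Defs
begin

text \<open>
  For fixed \<open>a\<close> on the unit circle, the four-variable objective is a binary quadratic form in
  \<open>(z1, z2)\<close> with matrix entries \<open>R11 T a\<close>, \<open>R12 T a\<close>, \<open>R22 T a\<close>. Its maximum on the unit circle is
  the larger eigenvalue of that matrix, which is half of the two-variable objective at \<open>a\<close>
  (lemmas \<open>binary_form_le_top_eigenvalue\<close> and \<open>top_eigenvalue_attained\<close>). Maximizing over \<open>z\<close> first
  and over \<open>a\<close> afterwards therefore gives the claim.

  Only the two-variable maximum needs a compactness argument: when \<open>a\<close> is a maximizer of it and \<open>z\<close>
  is a top eigenvector for this \<open>a\<close>, the pair \<open>(a, z)\<close> attains the four-variable maximum.
\<close>

lemma maximum_eqI:
  assumes "m \<in> S" "\<And>x. x \<in> S \<Longrightarrow> x \<le> m"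
  shows "maximum S = m"
  unfolding maximum_def using assms by (intro Greatest_equality) auto

text \<open>
  On the unit circle the form equals half of
  \<open>(p + r) * 1 + ((p - r, 2 * q) \<bullet> (z1\<^sup>2 - z2\<^sup>2, 2 * z1 * z2))\<close>, and the second vector of the
  inner product (the point with doubled angle) is again a unit vector. The Cauchy--Schwarz
  inequality bounds the inner product by the norm of \<open>(p - r, 2 * q)\<close>.
\<close>
lemma binary_form_le_top_eigenvalue:
  fixes p q r z1 z2 :: real
  assumes "z1\<^sup>2 + z2\<^sup>2 = 1"
  shows "z1\<^sup>2 * p + 2 * z1 * z2 * q + z2\<^sup>2 * r
           \<le> (p + r + sqrt ((p - r)\<^sup>2 + 4 * q\<^sup>2)) / 2"
proof -
  define C S where "C = z1\<^sup>2 - z2\<^sup>2" and "S = 2 * z1 * z2"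
  have "C\<^sup>2 + S\<^sup>2 = (z1\<^sup>2 + z2\<^sup>2)\<^sup>2"
    unfolding C_def S_def by algebra
  then have unit: "C\<^sup>2 + S\<^sup>2 = 1"
    using assms by simp
  have "((p - r) * C + 2 * q * S)\<^sup>2
          \<le> ((p - r) * C + 2 * q * S)\<^sup>2 + ((p - r) * S - 2 * q * C)\<^sup>2"
    by simp
  also have "\<dots> = ((p - r)\<^sup>2 + 4 * q\<^sup>2) * (C\<^sup>2 + S\<^sup>2)"
    by algebra
  finally have "((p - r) * C + 2 * q * S)\<^sup>2 \<le> (p - r)\<^sup>2 + 4 * q\<^sup>2"
    unfolding unit by simp
  then have "(p - r) * C + 2 * q * S \<le> sqrt ((p - r)\<^sup>2 + 4 * q\<^sup>2)"
    by (rule real_le_rsqrt)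
  moreover have "2 * (z1\<^sup>2 * p + 2 * z1 * z2 * q + z2\<^sup>2 * r)
                   = (p + r) * (z1\<^sup>2 + z2\<^sup>2) + ((p - r) * C + 2 * q * S)"
    unfolding C_def S_def by algebra
  ultimately show ?thesis
    using assms by simp
qed

text \<open>
  Equality in the Cauchy--Schwarz step requires the doubled angle of \<open>z\<close> to be the polar angle
  of \<open>(p - r, 2 * q)\<close>, so half of that angle serves as the angle of \<open>z\<close>.
\<close>
lemma top_eigenvalue_attained:
  fixes p q r :: real
  obtains z1 z2 :: real where "z1\<^sup>2 + z2\<^sup>2 = 1"
    "z1\<^sup>2 * p + 2 * z1 * z2 * q + z2\<^sup>2 * r = (p + r + sqrt ((p - r)\<^sup>2 + 4 * q\<^sup>2)) / 2"
proof -
  define \<rho> where "\<rho> = sqrt ((p - r)\<^sup>2 + 4 * q\<^sup>2)"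
  define w where "w = Complex (p - r) (2 * q)"
  define \<phi> where "\<phi> = Arg2pi w"
  have "cmod w = \<rho>"
    by (simp add: w_def \<rho>_def cmod_def power_mult_distrib)
  then have polar: "p - r = \<rho> * cos \<phi>" "2 * q = \<rho> * sin \<phi>"
    using cos_Arg2pi[of w] sin_Arg2pi[of w] by (simp_all add: \<phi>_def w_def)
  define z1 z2 where "z1 = cos (\<phi> / 2)" and "z2 = sin (\<phi> / 2)"
  have unit: "z1\<^sup>2 + z2\<^sup>2 = 1"
    by (simp add: z1_def z2_def)
  have double: "cos \<phi> = z1\<^sup>2 - z2\<^sup>2" "sin \<phi> = 2 * z1 * z2"
    using cos_double[of "\<phi> / 2"] sin_double[of "\<phi> / 2"] by (simp_all add: z1_def z2_def)
  have "2 * (z1\<^sup>2 * p + 2 * z1 * z2 * q + z2\<^sup>2 * r)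
          = (p + r) * (z1\<^sup>2 + z2\<^sup>2) + ((p - r) * cos \<phi> + 2 * q * sin \<phi>)"
    unfolding double by algebra
  also have "(p - r) * cos \<phi> + 2 * q * sin \<phi> = \<rho> * ((cos \<phi>)\<^sup>2 + (sin \<phi>)\<^sup>2)"
    unfolding polar by algebra
  finally show thesis
    using unit by (intro that[of z1 z2]) (simp_all add: \<rho>_def)
qed

lemma trilinear_extraordinary_eq_binary_form:
  assumes "susceptibility_tensor T" "a $ 3 = 0"
  shows "trilinear T a (extraordinary a z1 z2) (extraordinary a z1 z2)
           = z1\<^sup>2 * R11 T a + 2 * z1 * z2 * R12 T a + z2\<^sup>2 * R22 T a"
proof -
  have sym: "T $ i $ 2 $ 1 = T $ i $ 1 $ 2" "T $ i $ 3 $ 1 = T $ i $ 1 $ 3"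
      "T $ i $ 3 $ 2 = T $ i $ 2 $ 3" for i
    using assms(1) by (auto simp: susceptibility_tensor_def)
  show ?thesis
    unfolding trilinear_def extraordinary_def R11_def R12_def R22_def sum_3
    by (simp add: sym assms(2) algebra_simps power2_eq_square power3_eq_cube)
qed

lemma two_variable_objective_cong:
  assumes "a $ 1 = b $ 1" "a $ 2 = b $ 2"
  shows "two_variable_objective T a = two_variable_objective T b"
  using assms by (simp add: two_variable_objective_def R11_def R12_def R22_def)

text \<open>
  The angle parametrization exhibits the values as the image of a compact interval under a
  continuous function.
\<close>
lemma has_maximum_two_variable_values: "has_maximum (two_variable_values T)"
proof -
  define f where "f t = two_variable_objective T (vector [cos t, sin t, 0])" for t
  have "two_variable_values T = f ` {0..2 * pi}"
  proof (intro equalityI subsetI)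
    fix x assume "x \<in> two_variable_values T"
    then obtain a1 a2 where a: "a1\<^sup>2 + a2\<^sup>2 = 1"
      and x: "x = two_variable_objective T (vector [a1, a2, 0])"
      by (auto simp: two_variable_values_def)
    obtain t where "0 \<le> t" "t < 2 * pi" "a1 = cos t" "a2 = sin t"
      using sincos_total_2pi[OF a] by blast
    then show "x \<in> f ` {0..2 * pi}"
      using x by (auto simp: f_def)
  next
    fix x assume "x \<in> f ` {0..2 * pi}"
    then show "x \<in> two_variable_values T"
      unfolding two_variable_values_def f_def using sin_cos_squared_add2 by blast
  qed
  moreover have "continuous_on {0..2 * pi} f"
    unfolding f_def two_variable_objective_def R11_def R12_def R22_def
    by (simp, intro continuous_intros)
  ultimately have "compact (two_variable_values T)"
    by (simp add: compact_continuous_image)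
  moreover have "two_variable_values T \<noteq> {}"
    using \<open>two_variable_values T = f ` {0..2 * pi}\<close> by simp
  ultimately show ?thesis
    unfolding has_maximum_def by (rule compact_attains_sup)
qed

lemma four_variable_value_le_half_two_variable_value:
  assumes "susceptibility_tensor T" "x \<in> four_variable_values T"
  obtains y where "y \<in> two_variable_values T" "x \<le> y / 2"
proof -
  obtain a z1 z2 where x: "x = trilinear T a (extraordinary a z1 z2) (extraordinary a z1 z2)"
    and a: "(a $ 1)\<^sup>2 + (a $ 2)\<^sup>2 = 1" "a $ 3 = 0" and z: "z1\<^sup>2 + z2\<^sup>2 = 1"
    using assms(2) by (auto simp: four_variable_values_def)
  have "x \<le> two_variable_objective T a / 2"
    unfolding x trilinear_extraordinary_eq_binary_form[OF assms(1) a(2)]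
      two_variable_objective_def by (rule binary_form_le_top_eigenvalue[OF z])
  moreover have "two_variable_objective T a
                   = two_variable_objective T (vector [a $ 1, a $ 2, 0])"
    by (rule two_variable_objective_cong) simp_all
  then have "two_variable_objective T a \<in> two_variable_values T"
    unfolding two_variable_values_def using a(1) by blast
  ultimately show thesis
    by (rule that[rotated])
qed

lemma half_two_variable_value_in_four_variable_values:
  assumes "susceptibility_tensor T" "y \<in> two_variable_values T"
  shows "y / 2 \<in> four_variable_values T"
proof -
  obtain a1 a2 where a: "a1\<^sup>2 + a2\<^sup>2 = 1"
    and y: "y = two_variable_objective T (vector [a1, a2, 0])"
    using assms(2) by (auto simp: two_variable_values_def)
  define v :: "real ^ 3" where "v = vector [a1, a2, 0]"
  have v: "(v $ 1)\<^sup>2 + (v $ 2)\<^sup>2 = 1" "v $ 3 = 0"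
    using a by (simp_all add: v_def)
  obtain z1 z2 where z: "z1\<^sup>2 + z2\<^sup>2 = 1"
    and "z1\<^sup>2 * R11 T v + 2 * z1 * z2 * R12 T v + z2\<^sup>2 * R22 T v
           = two_variable_objective T v / 2"
    unfolding two_variable_objective_def by (rule top_eigenvalue_attained)
  then have "y / 2 = trilinear T v (extraordinary v z1 z2) (extraordinary v z1 z2)"
    by (simp add: y v_def[symmetric] trilinear_extraordinary_eq_binary_form[OF assms(1) v(2)])
  then show ?thesis
    unfolding four_variable_values_def using v z by blast
qed

theorem theorem3p2:
  fixes T :: tensor3
  assumes "susceptibility_tensor T"
  shows "has_maximum (four_variable_values T) \<and>
         has_maximum (two_variable_values T) \<and>
         d_eff2 T = 1 / 2 * maximum (two_variable_values T)"
proof -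
  obtain m where m: "m \<in> two_variable_values T" "\<And>y. y \<in> two_variable_values T \<Longrightarrow> y \<le> m"
    using has_maximum_two_variable_values[of T] by (auto simp: has_maximum_def)
  have attained: "m / 2 \<in> four_variable_values T"
    using half_two_variable_value_in_four_variable_values[OF assms m(1)] .
  have bound: "x \<le> m / 2" if "x \<in> four_variable_values T" for x
    using four_variable_value_le_half_two_variable_value[OF assms that] m(2)
    by (metis divide_right_mono order_trans zero_le_numeral)
  have "d_eff2 T = m / 2"
    unfolding d_eff2_def using attained bound by (rule maximum_eqI)
  moreover have "maximum (two_variable_values T) = m"
    using m by (rule maximum_eqI)
  moreover have "has_maximum (four_variable_values T)"
    unfolding has_maximum_def using attained bound by blast
  ultimately show ?thesis
    using has_maximum_two_variable_values by simp
qed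

end
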